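(* Let $u$ be a positive definite moment functional on $\Pi^d$, with reproducing kernels $\mathbf{P}_n(\cdot,\cdot)$ and $\mathbf{K}_n(\cdot,\cdot)$. Then for all $n\ge1$ and all $x,c\in\mathbb{R}^d$, $$\mathbf{P}_n(x,x)+\frac{[\mathbf{K}_{n-1}(x,c)]^2}{\mathbf{K}_{n-1}(c,c)}\ \ge\ \frac{[\mathbf{K}_n(x,c)]^2}{\mathbf{K}_n(c,c)} .$$
   Context: $\Pi^d$ is the space of real polynomials in $d$ variables, and $\Pi_n^d$ is the subspace of polynomials of total degree at most $n$. Write $r_n^d=\binom{n+d-1}{n}$. A moment functional is a real linear functional on $\Pi^d$, applied entrywise to matrices of polynomials; it is positive definite if $\langle u,p^2\rangle>0$ for all non-zero $p\in\Pi^d$. For such $u$ there is a sequence $\{\mathbb{P}_n\}_{n\ge0}$ of orthonormal polynomials: $\mathbb{P}_n$ is a column vector of $r_n^d$ polynomials in $\Pi_n^d$ and $\langle u,\mathbb{P}_n\mathbb{P}_m^T\rangle=\delta_{m,n}I_{r_n^d}$, where $I_{r_n^d}$ is the identity matrix. The kernels are $\mathbf{P}_k(x,y)=\mathbb{P}_k^T(x)\,\mathbb{P}_k(y)$ and $\mathbf{K}_n(x,y)=\sum_{k=0}^n\mathbf{P}_k(x,y)$; they do not depend on the choice of the orthonormal sequence. *)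

theory Defs
  imports "HOL-Analysis.Finite_Cartesian_Product" "HOL-Library.Poly_Mapping"
begin

text \<open>
  The variables are indexed by a finite type \<open>'n\<close>, so \<open>d = CARD('n)\<close> and \<open>d \<ge> 1\<close>.
  A polynomial maps exponent vectors to coefficients; multiplication on \<open>\<Rightarrow>\<^sub>0\<close>
  is convolution, hence the product of polynomials.
\<close>

type_synonym 'n mpoly = "('n \<Rightarrow>\<^sub>0 nat) \<Rightarrow>\<^sub>0 real"

definition monomial_degree :: "('n::finite \<Rightarrow>\<^sub>0 nat) \<Rightarrow> nat" where
  "monomial_degree a = (\<Sum>i\<in>UNIV. Poly_Mapping.lookup a i)"

definition poly_space :: "nat \<Rightarrow> 'n::finite mpoly set" where
  "poly_space n = {p. \<forall>a\<in>Poly_Mapping.keys p. monomial_degree a \<le> n}"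

definition eval_mpoly :: "'n::finite mpoly \<Rightarrow> real ^ 'n \<Rightarrow> real" where
  "eval_mpoly p x =
     (\<Sum>a\<in>Poly_Mapping.keys p.
        Poly_Mapping.lookup p a * (\<Prod>i\<in>UNIV. (x $ i) ^ Poly_Mapping.lookup a i))"

definition scale_mpoly :: "real \<Rightarrow> 'n::finite mpoly \<Rightarrow> 'n mpoly" where
  "scale_mpoly r p = Poly_Mapping.map ((*) r) p"

lemma vector_space_scale_mpoly: "vector_space scale_mpoly"
  by unfold_locales
    (simp_all add: scale_mpoly_def mult_map_scale_conv_mult single_add
      mult_single distrib_left distrib_right flip: mult.assoc)

definition moment_functional :: "('n::finite mpoly \<Rightarrow> real) \<Rightarrow> bool" where
  "moment_functional u \<longleftrightarrow> Vector_Spaces.linear scale_mpoly (*) u"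

definition positive_definite :: "('n::finite mpoly \<Rightarrow> real) \<Rightarrow> bool" where
  "positive_definite u \<longleftrightarrow> (\<forall>p. p \<noteq> 0 \<longrightarrow> u (p ^ 2) > 0)"

definition num_poly :: "nat \<Rightarrow> nat \<Rightarrow> nat" where
  "num_poly d n = (n + d - 1) choose n"

text \<open>
  A family \<open>P n i\<close> stands for the column vectors with entries \<open>P n i\<close>,
  \<open>i < num_poly d n\<close>; values at larger \<open>i\<close> are irrelevant. The second conjunct
  is the matrix identity \<open>u (P n * (P m)\<^sup>T) = \<delta> I\<close> entry by entry.
\<close>

definition orthonormal_sequence ::
    "('n::finite mpoly \<Rightarrow> real) \<Rightarrow> (nat \<Rightarrow> nat \<Rightarrow> 'n mpoly) \<Rightarrow> bool" where
  "orthonormal_sequence u P \<longleftrightarrow>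
     (\<forall>n. \<forall>i < num_poly CARD('n) n. P n i \<in> poly_space n) \<and>
     (\<forall>n m. \<forall>i < num_poly CARD('n) n. \<forall>j < num_poly CARD('n) m.
        u (P n i * P m j) = (if n = m \<and> i = j then 1 else 0))"

definition kernel_P ::
    "(nat \<Rightarrow> nat \<Rightarrow> 'n::finite mpoly) \<Rightarrow> nat \<Rightarrow> real ^ 'n \<Rightarrow> real ^ 'n \<Rightarrow> real" where
  "kernel_P P k x y =
     (\<Sum>i < num_poly CARD('n) k. eval_mpoly (P k i) x * eval_mpoly (P k i) y)"

definition kernel_K ::
    "(nat \<Rightarrow> nat \<Rightarrow> 'n::finite mpoly) \<Rightarrow> nat \<Rightarrow> real ^ 'n \<Rightarrow> real ^ 'n \<Rightarrow> real" where
  "kernel_K P n x y = (\<Sum>k\<le>n. kernel_P P k x y)"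

end

theory Submission
  imports Defs "HOL-Analysis.Convex"
begin

text \<open>
  Adding the degree-\<open>n\<close> block splits \<open>kernel_K P n\<close> as \<open>kernel_K P (n - 1) + kernel_P P n\<close> in both
  the numerator and the denominator on the right. The elementary inequality
  \<open>(a + b)\<^sup>2 / (A + B) \<le> a\<^sup>2 / A + b\<^sup>2 / B\<close>, which is subadditivity of
  the convex and homogeneous function \<open>(a, A) \<mapsto> a\<^sup>2 / A\<close> on \<open>A > 0\<close>, separates the
  two parts, and the Cauchy-Schwarz inequality for the block of degree \<open>n\<close> bounds
  \<open>(kernel_P P n x c)\<^sup>2 / kernel_P P n c c\<close> by \<open>kernel_P P n x x\<close>.

  Each kernel is a finite sum of products \<open>f i x * f i c\<close>, hence satisfies Cauchy-Schwarz.
  This also governs vanishing denominators: if the diagonal value at \<open>c\<close> is zero, so is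
  the corresponding value at \<open>(x, c)\<close>, and the quotient contributes nothing. This happens
  for \<open>kernel_P P n\<close> at a common zero \<open>c\<close> of the polynomials \<open>P n i\<close>.
\<close>

lemma kernel_P_Cauchy_Schwarz:
  "(kernel_P P k x y)\<^sup>2 \<le> kernel_P P k x x * kernel_P P k y y"
  unfolding kernel_P_def
  using Cauchy_Schwarz_ineq_sum[of "\<lambda>i. eval_mpoly (P k i) x" "\<lambda>i. eval_mpoly (P k i) y"]
  by (simp add: power2_eq_square)

lemma kernel_P_diagonal_nonneg: "0 \<le> kernel_P P k x x"
  by (simp add: kernel_P_def sum_nonneg)

lemma kernel_K_diagonal_nonneg: "0 \<le> kernel_K P n x x"
  by (simp add: kernel_K_def sum_nonneg kernel_P_diagonal_nonneg)

lemma kernel_K_Cauchy_Schwarz: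
  "(kernel_K P n x y)\<^sup>2 \<le> kernel_K P n x x * kernel_K P n y y"
  for P :: "nat \<Rightarrow> nat \<Rightarrow> 'n::finite mpoly"
proof -
  \<comment> \<open>Flattening the double sum exhibits \<open>kernel_K\<close> as a single inner product.\<close>
  have flat: "kernel_K P n s t =
      (\<Sum>(k, i)\<in>(SIGMA k:{..n}. {..<num_poly CARD('n) k}).
         eval_mpoly (P k i) s * eval_mpoly (P k i) t)" for s t
    by (simp add: kernel_K_def kernel_P_def sum.Sigma)
  show ?thesis
    unfolding flat
    using Cauchy_Schwarz_ineq_sum[of "\<lambda>(k, i). eval_mpoly (P k i) x" "\<lambda>(k, i). eval_mpoly (P k i) y"
        "SIGMA k:{..n}. {..<num_poly CARD('n) k}"]
    by (simp add: power2_eq_square case_prod_unfold)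
qed

lemma kernel_K_step: "1 \<le> n \<Longrightarrow> kernel_K P n x y = kernel_K P (n - 1) x y + kernel_P P n x y"
  by (cases n) (simp_all add: kernel_K_def)

text \<open>
  For \<open>A, B > 0\<close>, the difference \<open>a\<^sup>2 / A + b\<^sup>2 / B - (a + b)\<^sup>2 / (A + B)\<close> equals
  \<open>(a * B - b * A)\<^sup>2 / (A * B * (A + B))\<close>.
\<close>
lemma square_sum_divide_le:
  fixes a b A B :: real
  assumes "0 < A" and "0 < B"
  shows "(a + b)\<^sup>2 / (A + B) \<le> a\<^sup>2 / A + b\<^sup>2 / B"
proof -
  have "a\<^sup>2 / A + b\<^sup>2 / B - (a + b)\<^sup>2 / (A + B) = (a * B - b * A)\<^sup>2 / (A * B * (A + B))"
    using assms add_pos_pos[OF assms] by (simp add: divide_simps) algebra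
  moreover have "0 \<le> (a * B - b * A)\<^sup>2 / (A * B * (A + B))"
    using assms by simp
  ultimately show ?thesis
    by linarith
qed

text \<open>
  The form needed for kernels, where denominators may vanish: the bound
  \<open>a\<^sup>2 \<le> q * A\<close> serves to force \<open>a = 0\<close> when \<open>A = 0\<close>.
\<close>
lemma square_sum_divide_le_of_bounds:
  fixes a b A B p q :: real
  assumes "0 \<le> A" "0 \<le> B" "0 \<le> p" and a: "a\<^sup>2 \<le> q * A" and b: "b\<^sup>2 \<le> p * B"
  shows "(a + b)\<^sup>2 / (A + B) \<le> p + a\<^sup>2 / A"
proof -
  have quot: "b\<^sup>2 / B \<le> p"
    using assms by (cases "B = 0") (simp_all add: pos_divide_le_eq)
  consider "A = 0" | "B = 0" | "0 < A" "0 < B"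
    using assms by linarith
  then show ?thesis
  proof cases
    case 1
    then show ?thesis
      using a quot by simp
  next
    case 2
    then show ?thesis
      using b \<open>0 \<le> p\<close> by simp
  next
    case 3
    then show ?thesis
      using square_sum_divide_le[of A B a b] quot by linarith
  qed
qed

theorem proposition5:
  fixes u :: "'n::finite mpoly \<Rightarrow> real"
    and P :: "nat \<Rightarrow> nat \<Rightarrow> 'n mpoly"
    and n :: nat
    and x c :: "real ^ 'n"
  assumes "moment_functional u"
    and "positive_definite u"
    and "orthonormal_sequence u P"
    and "n \<ge> 1"
  shows "kernel_P P n x x + (kernel_K P (n - 1) x c)\<^sup>2 / kernel_K P (n - 1) c c
           \<ge> (kernel_K P n x c)\<^sup>2 / kernel_K P n c c"
  unfolding kernel_K_step[OF \<open>n \<ge> 1\<close>]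
  by (rule square_sum_divide_le_of_bounds[OF kernel_K_diagonal_nonneg kernel_P_diagonal_nonneg
        kernel_P_diagonal_nonneg kernel_K_Cauchy_Schwarz kernel_P_Cauchy_Schwarz])

end
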